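(* Let $k\ge 1$ be an integer, let $\gamma=\{\gamma_n\}_{n\ge 0}$ be a sequence of non-negative real numbers, and suppose that the Hankel matrix $M_\gamma$ is $k$-positive. Suppose that there exists an integer $n_0\ge 0$ such that $\det([M_\gamma]^{n_0}_{k-1})=0$. Then $\det([M_\gamma]^{n}_{k-1})=0$ for all $n\ge 1$.
   Context: For a sequence $\gamma=\{\gamma_n\}_{n\ge 0}$ of non-negative real numbers, $M_\gamma=(\gamma_{i+j})_{i,j\ge 0}$ is the associated infinite Hankel matrix. For integers $m,n\ge 0$, $[M_\gamma]^n_m=(\gamma_{n+i+j})_{0\le i,j\le m}$ denotes the $(m+1)\times(m+1)$ Hankel sub-matrix. The matrix $M_\gamma$ (or the sequence $\gamma$) is called $k$-positive if $[M_\gamma]^n_k$ is positive semi-definite for every integer $n\ge 0$. The set of $k$-positive matrices is denoted $\mathcal{C}_+^k$. *)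

theory Defs
  imports "Jordan_Normal_Form.Determinant"
begin

definition pos_semidef :: "real mat \<Rightarrow> bool" where
  "pos_semidef A \<longleftrightarrow> square_mat A \<and> A\<^sup>T = A \<and>
     (\<forall>v \<in> carrier_vec (dim_row A). 0 \<le> v \<bullet> (A *\<^sub>v v))"

(* hankel_block \<gamma> n m is [M_\<gamma>]^n_m: n is the shift and m the largest index,
   so the matrix has size m + 1. *)
definition hankel_block :: "(nat \<Rightarrow> real) \<Rightarrow> nat \<Rightarrow> nat \<Rightarrow> real mat" where
  "hankel_block \<gamma> n m = mat (m + 1) (m + 1) (\<lambda>(i, j). \<gamma> (n + i + j))"

(* The infinite Hankel matrix M_\<gamma> is represented by the sequence \<gamma> that determines it. *)
definition k_positive :: "nat \<Rightarrow> (nat \<Rightarrow> real) \<Rightarrow> bool" where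
  "k_positive k \<gamma> \<longleftrightarrow> (\<forall>n. pos_semidef (hankel_block \<gamma> n k))"

end

theory Submission
  imports Defs
begin

text \<open>
  If \<open>v\<close> is in the kernel of the block of size \<open>k\<close> at shift \<open>n\<close>, then padding \<open>v\<close> with a zero
  at the end, respectively at the front, gives an isotropic vector of the block of size \<open>k + 1\<close>
  at shift \<open>n\<close>, respectively \<open>n - 2\<close>. An isotropic vector of a positive semi-definite matrix
  lies in its kernel, so \<open>v\<close> is in the kernel of the blocks of size \<open>k\<close> at shifts \<open>n + 1\<close> and
  \<open>n - 1\<close>. The second argument needs \<open>n \<ge> 2\<close>, which is why the shift \<open>0\<close> is never reached.
\<close>

text \<open>With \<open>z = A *\<^sub>v w\<close>, symmetry makes the quadratic form at
  \<open>w + t \<cdot>\<^sub>v z\<close> equal to \<open>2 * t * s + t * t * c\<close>, where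
  \<open>s\<close> is the squared length of \<open>z\<close>. If \<open>s\<close> were positive, the
  linear term would make this negative for small negative \<open>t\<close>.\<close>

lemma pos_semidef_isotropic_imp_kernel:
  assumes psd: "pos_semidef A" and A: "A \<in> carrier_mat n n" and w: "w \<in> carrier_vec n"
    and iso: "w \<bullet> (A *\<^sub>v w) = 0"
  shows "A *\<^sub>v w = 0\<^sub>v n"
proof -
  define z where "z = A *\<^sub>v w"
  define s where "s = z \<bullet> z"
  define c where "c = z \<bullet> (A *\<^sub>v z)"
  have z: "z \<in> carrier_vec n" using A w by (simp add: z_def)
  have Az: "A *\<^sub>v z \<in> carrier_vec n" using A z by simp
  have sym: "A\<^sup>T = A" and nonneg: "\<And>v. v \<in> carrier_vec n \<Longrightarrow> 0 \<le> v \<bullet> (A *\<^sub>v v)"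
    using psd A by (auto simp: pos_semidef_def)
  have wAz: "w \<bullet> (A *\<^sub>v z) = s"
    using transpose_vec_mult_scalar[OF A z w] sym by (simp add: s_def z_def)
  have c0: "0 \<le> c" using nonneg[OF z] by (simp add: c_def)
  \<comment> \<open>The minimiser would be \<open>- s / c\<close>, but \<open>c\<close> may be 0;
    the denominator \<open>c + 1\<close> is always positive and still gives a negative value unless
    \<open>s = 0\<close>.\<close>
  define t where "t = - s / (c + 1)"
  have "A *\<^sub>v (w + t \<cdot>\<^sub>v z) = z + t \<cdot>\<^sub>v (A *\<^sub>v z)"
    using A w z by (simp add: mult_add_distrib_mat_vec mult_mat_vec z_def)
  then have "(w + t \<cdot>\<^sub>v z) \<bullet> (A *\<^sub>v (w + t \<cdot>\<^sub>v z)) = w \<bullet> z + t * s + t * s + t * t * c"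
    using w z Az wAz
    by (simp add: add_scalar_prod_distrib[of _ n] scalar_prod_add_distrib[of _ n]
        s_def[symmetric] c_def[symmetric] algebra_simps)
  then have "0 \<le> 2 * t * s + t * t * c"
    using nonneg[of "w + t \<cdot>\<^sub>v z"] w z iso by (simp add: z_def mult_ac)
  also have "2 * t * s + t * t * c = - (s\<^sup>2 * (c + 2) / (c + 1)\<^sup>2)"
    using c0 by (simp add: t_def power2_eq_square divide_simps) (simp add: algebra_simps)
  finally have "s\<^sup>2 * (c + 2) / (c + 1)\<^sup>2 \<le> 0" by simp
  then have "s = 0"
    using c0 by (simp add: divide_le_0_iff mult_le_0_iff)
  then have "z $ i = 0" if "i < n" for i
    using z that by (auto simp: s_def scalar_prod_def sum_nonneg_eq_0_iff)
  then have "z = 0\<^sub>v n"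
    using z by (intro eq_vecI) auto
  then show ?thesis by (simp add: z_def)
qed

lemma hankel_block_carrier [simp]: "hankel_block \<gamma> n m \<in> carrier_mat (Suc m) (Suc m)"
  by (simp add: hankel_block_def)

lemma hankel_block_mult_vec_index:
  assumes "v \<in> carrier_vec (Suc m)" "i \<le> m"
  shows "(hankel_block \<gamma> n m *\<^sub>v v) $ i = (\<Sum>j<Suc m. \<gamma> (n + i + j) * v $ j)"
  using assms
  by (auto simp: hankel_block_def scalar_prod_def lessThan_atLeast0 less_Suc_eq_le intro!: sum.cong)

lemma hankel_block_kernel_iff:
  assumes "v \<in> carrier_vec (Suc m)"
  shows "hankel_block \<gamma> n m *\<^sub>v v = 0\<^sub>v (Suc m) \<longleftrightarrow>
    (\<forall>i\<le>m. (\<Sum>j<Suc m. \<gamma> (n + i + j) * v $ j) = 0)"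
proof -
  have "dim_vec (hankel_block \<gamma> n m *\<^sub>v v) = Suc m" by (simp add: hankel_block_def)
  then show ?thesis
    using hankel_block_mult_vec_index[OF assms]
    by (auto simp: vec_eq_iff less_Suc_eq_le simp del: index_mult_mat_vec sum.lessThan_Suc)
qed

lemma det_hankel_block_zero_iff:
  "det (hankel_block \<gamma> n m) = 0 \<longleftrightarrow>
    (\<exists>v\<in>carrier_vec (Suc m). v \<noteq> 0\<^sub>v (Suc m) \<and> hankel_block \<gamma> n m *\<^sub>v v = 0\<^sub>v (Suc m))"
  using det_0_iff_vec_prod_zero[OF hankel_block_carrier] by blast

lemma hankel_block_kernel_Suc:
  assumes psd: "pos_semidef (hankel_block \<gamma> n (Suc m))"
    and v: "v \<in> carrier_vec (Suc m)" and ker: "hankel_block \<gamma> n m *\<^sub>v v = 0\<^sub>v (Suc m)"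
  shows "hankel_block \<gamma> (Suc n) m *\<^sub>v v = 0\<^sub>v (Suc m)"
proof -
  define w where "w = vec (Suc (Suc m)) (\<lambda>i. if i < Suc m then v $ i else 0)"
  let ?B = "hankel_block \<gamma> n (Suc m)"
  have w: "w \<in> carrier_vec (Suc (Suc m))" by (simp add: w_def)
  \<comment> \<open>Entries 0 to \<open>m\<close> are the product of \<open>v\<close> with the block
    at shift \<open>n\<close>; entries 1 to \<open>Suc m\<close> are its product with the block at
    shift \<open>Suc n\<close>.\<close>
  have Bw: "(?B *\<^sub>v w) $ i = (\<Sum>j<Suc m. \<gamma> (n + i + j) * v $ j)" if "i \<le> Suc m" for i
    unfolding hankel_block_mult_vec_index[OF w that] sum.lessThan_Suc[of _ "Suc m"]
    by (simp add: w_def)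
  have Bw0: "(?B *\<^sub>v w) $ i = 0" if "i < Suc m" for i
    using Bw[of i] ker hankel_block_kernel_iff[OF v] that by simp
  \<comment> \<open>Only the last entry of the product can be nonzero, and there \<open>w\<close>
    vanishes.\<close>
  have "w \<bullet> (?B *\<^sub>v w) = 0"
    unfolding scalar_prod_def
    by (rule sum.neutral) (use Bw0 in \<open>auto simp: w_def hankel_block_def\<close>)
  then have "?B *\<^sub>v w = 0\<^sub>v (Suc (Suc m))"
    by (rule pos_semidef_isotropic_imp_kernel[OF psd hankel_block_carrier w])
  then have "(\<Sum>j<Suc m. \<gamma> (Suc n + i + j) * v $ j) = 0" if "i \<le> m" for i
    using Bw[of "Suc i"] that by simp
  then show ?thesis using hankel_block_kernel_iff[OF v] by blast
qed

lemma hankel_block_kernel_pred: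
  assumes psd: "pos_semidef (hankel_block \<gamma> n (Suc m))"
    and v: "v \<in> carrier_vec (Suc m)" and ker: "hankel_block \<gamma> (Suc (Suc n)) m *\<^sub>v v = 0\<^sub>v (Suc m)"
  shows "hankel_block \<gamma> (Suc n) m *\<^sub>v v = 0\<^sub>v (Suc m)"
proof -
  define w where "w = vec (Suc (Suc m)) (\<lambda>i. if i = 0 then 0 else v $ (i - 1))"
  let ?B = "hankel_block \<gamma> n (Suc m)"
  have w: "w \<in> carrier_vec (Suc (Suc m))" by (simp add: w_def)
  \<comment> \<open>The leading zero of \<open>w\<close> raises the shift by one: entries 0 to
    \<open>m\<close> belong to shift \<open>Suc n\<close>, entries 1 to \<open>Suc m\<close> to
    shift \<open>Suc (Suc n)\<close>.\<close>
  have Bw: "(?B *\<^sub>v w) $ i = (\<Sum>j<Suc m. \<gamma> (Suc n + i + j) * v $ j)" if "i \<le> Suc m" for i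
    unfolding hankel_block_mult_vec_index[OF w that] sum.lessThan_Suc_shift[of _ "Suc m"]
    by (simp add: w_def)
  have Bw0: "(?B *\<^sub>v w) $ Suc i = 0" if "i < Suc m" for i
    using Bw[of "Suc i"] ker hankel_block_kernel_iff[OF v] that by simp
  have "w $ i * (?B *\<^sub>v w) $ i = 0" if "i < Suc (Suc m)" for i
    using that Bw0[of "i - 1"] by (cases i) (simp_all add: w_def)
  then have "w \<bullet> (?B *\<^sub>v w) = 0"
    unfolding scalar_prod_def by (intro sum.neutral) (auto simp: hankel_block_def)
  then have "?B *\<^sub>v w = 0\<^sub>v (Suc (Suc m))"
    by (rule pos_semidef_isotropic_imp_kernel[OF psd hankel_block_carrier w])
  then have "(\<Sum>j<Suc m. \<gamma> (Suc n + i + j) * v $ j) = 0" if "i \<le> m" for i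
    using Bw[of i] that by simp
  then show ?thesis using hankel_block_kernel_iff[OF v] by blast
qed

theorem theorem3p2:
  fixes \<gamma> :: "nat \<Rightarrow> real" and k :: nat
  assumes "k \<ge> 1"
    and "\<And>n. \<gamma> n \<ge> 0"
    and "k_positive k \<gamma>"
    and "\<exists>n\<^sub>0. det (hankel_block \<gamma> n\<^sub>0 (k - 1)) = 0"
  shows "\<forall>n\<ge>1. det (hankel_block \<gamma> n (k - 1)) = 0"
proof -
  obtain m where k: "k = Suc m" using assms(1) by (cases k) auto
  let ?P = "\<lambda>n. det (hankel_block \<gamma> n m) = 0"
  have psd: "pos_semidef (hankel_block \<gamma> n (Suc m))" for n
    using assms(3) by (simp add: k_positive_def k)
  have up: "?P (Suc n)" if "?P n" for n
    using that hankel_block_kernel_Suc[OF psd] unfolding det_hankel_block_zero_iff by blast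
  have down: "?P (Suc n)" if "?P (Suc (Suc n))" for n
    using that hankel_block_kernel_pred[OF psd] unfolding det_hankel_block_zero_iff by blast
  obtain n\<^sub>0 where "?P n\<^sub>0" using assms(4) by (auto simp: k)
  then have "?P (Suc n\<^sub>0)" by (rule up)
  \<comment> \<open>Having first gone up to \<open>Suc n\<^sub>0\<close>, the descent by
    \<open>down\<close> starts at a shift of at least 1, so \<open>n\<^sub>0 = 0\<close> needs no
    separate case.\<close>
  then have one: "?P (Suc 0)" by (induction n\<^sub>0) (use down in blast)+
  have "?P n" if "1 \<le> n" for n
    using that by (induction n rule: dec_induct) (use one up in simp_all)
  then show ?thesis by (simp add: k)
qed

end
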